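(* For every sequent $\Gamma\Rightarrow\delta$ of first-order arithmetic: if $\mathrm{CHA}\vdash\Gamma\Rightarrow\delta$ then $\mathrm{SHA}\vdash\Gamma\Rightarrow\delta$.
   Context: Language: terms from variables, $0,S,+,\cdot$; formulas from $s=t,\bot,\wedge,\vee,\to,\forall,\exists$. $\mathrm{HA}$-sequents $\Gamma\Rightarrow\delta$: finite set $\Gamma$, single formula $\delta$. $\mathrm{CHA}$: sequent calculus with the standard intuitionistic rules Ax ($\Gamma,\delta\Rightarrow\delta$), $\to$L/R, $\wedge$L/R, $\vee$L/R, $\forall$L/R, $\exists$L/R (usual eigenvariable conditions), $\bot$L, $=$L (from $\Gamma[x/y]\Rightarrow\delta[x/y]$ infer $\Gamma[s/x,t/y],s=t\Rightarrow\delta[s/x,t/y]$, $x,y\notin\mathrm{FV}(s,t)$), $=$R ($\Gamma\Rightarrow t=t$), weakening, cut, arithmetic axioms $\Rightarrow 0\neq St$, $Ss=St\Rightarrow s=t$, $\Rightarrow s+0=s$, $\Rightarrow s+St=S(s+t)$, $\Rightarrow s\cdot0=0$, $\Rightarrow s\cdot St=(s\cdot t)+s$, and $\textsc{Case}_x$ (from $\Gamma[0/x]\Rightarrow\delta[0/x]$ and $\Gamma[Sx/x]\Rightarrow\delta[Sx/x]$ infer $\Gamma\Rightarrow\delta$). Pre-proofs are finite trees with a partial map $\beta$ from some leaves (buds) to inner nodes (companions); non-bud nodes carry rule instances whose premises label the children; buds carry their companion's sequent. Infinite branches start at the root and step to a child or from a bud to its companion. A $\mathrm{CHA}$-proof is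 a pre-proof such that along every infinite branch some variable $x$ is, from some point on, free in every sequent and the branch passes instances of $\textsc{Case}_x$ infinitely often. $\mathrm{SHA}$ (stack-labelled Heyting arithmetic): a companion label is $x^\bullet\mapsto\Gamma\Rightarrow\delta$ with $\Gamma\Rightarrow\delta$ an $\mathrm{HA}$-sequent, $x\in\mathrm{FV}(\Gamma,\delta)$, $x^\bullet\in\{x^+,x^-\}$. A stack $\Lambda$ is a finite list of labels (written $\Lambda;\ell$ when $\ell$ is appended last), $\varepsilon$ the empty list, $\textsc{Var}(\Lambda)$ the set of variables of its labels. $\Lambda^{+x}$ replaces every $x^-$ in $\Lambda$ by $x^+$. $\mathrm{SHA}$-sequents are $\Lambda\mid\Gamma\Rightarrow\delta$; such a sequent is well-formed if every variable in $\textsc{Var}(\Lambda)$ is free in $\Gamma,\delta$. Rules: (i) every logical rule of $\mathrm{HA}$ listed above (including weakening, cut, $=$L, $=$R, $\bot$L) with the same stack $\Lambda$ in conclusion and all premises, where the eigenvariable of $\forall$R/$\exists$L must also not occur in $\Lambda$; (ii) Ax and the arithmetic axioms only with empty stack, e.g. $\varepsilon\mid\Gamma,\delta\Rightarrow\delta$, $\varepsilon\mid\Gamma\Rightarrow 0\neq St$, $\varepsilon\mid\Gamma,Ss=St\Rightarrow s=t$, etc.; (iii) label rules: Comp (from $\Lambda;(x^-\mapsto\Gamma\Rightarrow\delta)\mid\Gamma\Rightarrow\delta$ infer $\Lambda\mid\Gamma\Rightarrow\delta$), Bud (axiom $\Lambda;(x^+\mapsto\Gamma\Rightarrow\delta)\mid\Gamma\Rightarrow\delta$),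 Pop (from $\Lambda\mid\Gamma\Rightarrow\delta$ infer $\Lambda;\Lambda'\mid\Gamma\Rightarrow\delta$), $\textsc{Case}_x$ (from $\Lambda\mid\Gamma[0/x]\Rightarrow\delta[0/x]$ and $\Lambda^{+x}\mid\Gamma[Sx/x]\Rightarrow\delta[Sx/x]$ infer $\Lambda\mid\Gamma\Rightarrow\delta$). $\mathrm{SHA}$-proofs are finite (non-cyclic) trees; every rule except Pop may only derive well-formed sequents. $\mathrm{SHA}\vdash\Gamma\Rightarrow\delta$ means there is an $\mathrm{SHA}$-proof of $\varepsilon\mid\Gamma\Rightarrow\delta$. *)

theory Defs
  imports Main "HOL-Library.FSet" "HOL-Library.Infinite_Set"
begin

section \<open>Language of arithmetic\<close>

text \<open>
  Formulas are represented up to renaming of bound variables, by de Bruijn indices.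
  Free variables are identified with natural numbers: under \<open>d\<close> quantifiers, the indices
  below \<open>d\<close> are bound, and index \<open>d + x\<close> is an occurrence of the free variable \<open>x\<close>.
  So at top level \<open>Var x\<close> is simply the variable \<open>x\<close>, and every element of the type
  \<open>fm\<close> is a formula.
\<close>

type_synonym var = nat

datatype tm = Var var | Zero | Succ tm | Plus tm tm | Times tm tm

datatype fm =
    Eq tm tm
  | Bot
  | And fm fm
  | Or fm fm
  | Imp fm fm
  | All fm
  | Ex fm

abbreviation Neg :: "fm \<Rightarrow> fm" where
  "Neg \<phi> \<equiv> Imp \<phi> Bot"

primrec fv_tm :: "tm \<Rightarrow> var set" where
  "fv_tm (Var x) = {x}"
| "fv_tm Zero = {}"
| "fv_tm (Succ t) = fv_tm t"
| "fv_tm (Plus s t) = fv_tm s \<union> fv_tm t"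
| "fv_tm (Times s t) = fv_tm s \<union> fv_tm t"

primrec fv :: "fm \<Rightarrow> var set" where
  "fv (Eq s t) = fv_tm s \<union> fv_tm t"
| "fv Bot = {}"
| "fv (And \<phi> \<psi>) = fv \<phi> \<union> fv \<psi>"
| "fv (Or \<phi> \<psi>) = fv \<phi> \<union> fv \<psi>"
| "fv (Imp \<phi> \<psi>) = fv \<phi> \<union> fv \<psi>"
| "fv (All \<phi>) = {x. Suc x \<in> fv \<phi>}"
| "fv (Ex \<phi>) = {x. Suc x \<in> fv \<phi>}"

primrec subst_tm :: "(var \<Rightarrow> tm) \<Rightarrow> tm \<Rightarrow> tm" where
  "subst_tm \<sigma> (Var x) = \<sigma> x"
| "subst_tm \<sigma> Zero = Zero"
| "subst_tm \<sigma> (Succ t) = Succ (subst_tm \<sigma> t)"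
| "subst_tm \<sigma> (Plus s t) = Plus (subst_tm \<sigma> s) (subst_tm \<sigma> t)"
| "subst_tm \<sigma> (Times s t) = Times (subst_tm \<sigma> s) (subst_tm \<sigma> t)"

text \<open>Passing under a quantifier: index 0 is kept and the terms of \<open>\<sigma>\<close> are shifted by one.\<close>

definition lift :: "(var \<Rightarrow> tm) \<Rightarrow> var \<Rightarrow> tm" where
  "lift \<sigma> = case_nat (Var 0) (\<lambda>x. subst_tm (\<lambda>y. Var (Suc y)) (\<sigma> x))"

text \<open>Simultaneous capture-avoiding substitution; \<open>\<phi>[t/x]\<close> is \<open>subst (Var(x := t)) \<phi>\<close>.\<close>

primrec subst :: "(var \<Rightarrow> tm) \<Rightarrow> fm \<Rightarrow> fm" where
  "subst \<sigma> (Eq s t) = Eq (subst_tm \<sigma> s) (subst_tm \<sigma> t)"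
| "subst \<sigma> Bot = Bot"
| "subst \<sigma> (And \<phi> \<psi>) = And (subst \<sigma> \<phi>) (subst \<sigma> \<psi>)"
| "subst \<sigma> (Or \<phi> \<psi>) = Or (subst \<sigma> \<phi>) (subst \<sigma> \<psi>)"
| "subst \<sigma> (Imp \<phi> \<psi>) = Imp (subst \<sigma> \<phi>) (subst \<sigma> \<psi>)"
| "subst \<sigma> (All \<phi>) = All (subst (lift \<sigma>) \<phi>)"
| "subst \<sigma> (Ex \<phi>) = Ex (subst (lift \<sigma>) \<phi>)"

text \<open>For the body \<open>\<phi>\<close> of a quantifier, \<open>inst t \<phi>\<close> is the instance of \<open>\<phi>\<close> with \<open>t\<close> for the
  quantified variable; the remaining indices go down by one since the quantifier is removed.\<close>

definition inst :: "tm \<Rightarrow> fm \<Rightarrow> fm" where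
  "inst t = subst (case_nat t Var)"

text \<open>The named quantifications of \<open>\<phi>\<close> over \<open>x\<close> are \<open>All (abstr x \<phi>)\<close> and \<open>Ex (abstr x \<phi>)\<close>.
  The definition is not used below; the lemmas after it relate the quantifier rules, stated with
  \<open>inst\<close>, to named quantifiers.\<close>

definition abstr :: "var \<Rightarrow> fm \<Rightarrow> fm" where
  "abstr x = subst (\<lambda>y. if y = x then Var 0 else Var (Suc y))"

lemma fv_subst_tm: "fv_tm (subst_tm \<sigma> t) = (\<Union>x\<in>fv_tm t. fv_tm (\<sigma> x))"
  by (induction t) auto

lemma fv_lift: "Suc y \<in> fv_tm (lift \<sigma> x) \<longleftrightarrow> (\<exists>z. x = Suc z \<and> y \<in> fv_tm (\<sigma> z))"
  by (cases x) (simp_all add: lift_def fv_subst_tm)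

lemma fv_subst: "fv (subst \<sigma> \<phi>) = (\<Union>x\<in>fv \<phi>. fv_tm (\<sigma> x))"
proof (induction \<phi> arbitrary: \<sigma>)
  case (All \<phi>)
  show ?case by (simp only: subst.simps fv.simps All.IH UN_iff fv_lift) blast
next
  case (Ex \<phi>)
  show ?case by (simp only: subst.simps fv.simps Ex.IH UN_iff fv_lift) blast
qed (simp_all add: fv_subst_tm UN_Un)

lemma fv_All_abstr: "fv (All (abstr x \<phi>)) = fv \<phi> - {x}"
  by (auto simp: abstr_def fv_subst split: if_splits)

lemma subst_subst_tm: "subst_tm \<tau> (subst_tm \<sigma> t) = subst_tm (\<lambda>x. subst_tm \<tau> (\<sigma> x)) t"
  by (induction t) auto

lemma lift_comp: "(\<lambda>x. subst_tm (lift \<tau>) (lift \<sigma> x)) = lift (\<lambda>x. subst_tm \<tau> (\<sigma> x))"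
  by (rule ext) (simp add: lift_def subst_subst_tm split: nat.splits)

lemma subst_subst: "subst \<tau> (subst \<sigma> \<phi>) = subst (\<lambda>x. subst_tm \<tau> (\<sigma> x)) \<phi>"
  by (induction \<phi> arbitrary: \<sigma> \<tau>) (auto simp: subst_subst_tm lift_comp)

lemma inst_abstr: "inst t (abstr x \<phi>) = subst (Var(x := t)) \<phi>"
proof -
  have "(\<lambda>y. subst_tm (case_nat t Var) (if y = x then Var 0 else Var (Suc y))) = Var(x := t)"
    by auto
  then show ?thesis by (simp add: inst_def abstr_def subst_subst)
qed

type_synonym sequent = "fm fset \<times> fm"

definition fv_seq :: "sequent \<Rightarrow> var set" where
  "fv_seq S = (\<Union>\<phi>\<in>fset (fst S). fv \<phi>) \<union> fv (snd S)"

definition subst_seq :: "(var \<Rightarrow> tm) \<Rightarrow> sequent \<Rightarrow> sequent" where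
  "subst_seq \<sigma> S = (subst \<sigma> |`| fst S, subst \<sigma> (snd S))"


section \<open>Rules shared by CHA and SHA\<close>

text \<open>\<open>logical_rule E Ps S\<close>: the conclusion \<open>S\<close> follows from the list of premises \<open>Ps\<close> by a
  logical or structural rule other than Ax; \<open>E\<close> is the set of eigenvariables of the instance.\<close>

inductive logical_rule :: "var set \<Rightarrow> sequent list \<Rightarrow> sequent \<Rightarrow> bool" where
  ImpL: "logical_rule {} [(\<Gamma>, \<phi>), (finsert \<psi> \<Gamma>, \<delta>)] (finsert (Imp \<phi> \<psi>) \<Gamma>, \<delta>)"
| ImpR: "logical_rule {} [(finsert \<phi> \<Gamma>, \<psi>)] (\<Gamma>, Imp \<phi> \<psi>)"
| AndL: "logical_rule {} [(finsert \<phi> (finsert \<psi> \<Gamma>), \<delta>)] (finsert (And \<phi> \<psi>) \<Gamma>, \<delta>)"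
| AndR: "logical_rule {} [(\<Gamma>, \<phi>), (\<Gamma>, \<psi>)] (\<Gamma>, And \<phi> \<psi>)"
| OrL: "logical_rule {} [(finsert \<phi> \<Gamma>, \<delta>), (finsert \<psi> \<Gamma>, \<delta>)] (finsert (Or \<phi> \<psi>) \<Gamma>, \<delta>)"
| OrR1: "logical_rule {} [(\<Gamma>, \<phi>)] (\<Gamma>, Or \<phi> \<psi>)"
| OrR2: "logical_rule {} [(\<Gamma>, \<psi>)] (\<Gamma>, Or \<phi> \<psi>)"
| AllL: "logical_rule {} [(finsert (inst t \<phi>) \<Gamma>, \<delta>)] (finsert (All \<phi>) \<Gamma>, \<delta>)"
| AllR: "y \<notin> fv_seq (\<Gamma>, All \<phi>) \<Longrightarrow>
    logical_rule {y} [(\<Gamma>, inst (Var y) \<phi>)] (\<Gamma>, All \<phi>)"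
| ExL: "y \<notin> fv_seq (finsert (Ex \<phi>) \<Gamma>, \<delta>) \<Longrightarrow>
    logical_rule {y} [(finsert (inst (Var y) \<phi>) \<Gamma>, \<delta>)] (finsert (Ex \<phi>) \<Gamma>, \<delta>)"
| ExR: "logical_rule {} [(\<Gamma>, inst t \<phi>)] (\<Gamma>, Ex \<phi>)"
| BotL: "logical_rule {} [] (finsert Bot \<Gamma>, \<delta>)"
| EqL: "x \<noteq> y \<Longrightarrow> {x, y} \<inter> (fv_tm s \<union> fv_tm t) = {} \<Longrightarrow>
    logical_rule {} [subst_seq (Var(y := Var x)) (\<Gamma>, \<delta>)]
      (finsert (Eq s t) (subst (Var(x := s, y := t)) |`| \<Gamma>), subst (Var(x := s, y := t)) \<delta>)"
| EqR: "logical_rule {} [] (\<Gamma>, Eq t t)"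
| Weak: "\<Gamma> |\<subseteq>| \<Gamma>' \<Longrightarrow> logical_rule {} [(\<Gamma>, \<delta>)] (\<Gamma>', \<delta>)"
| Cut: "logical_rule {} [(\<Gamma>, \<phi>), (finsert \<phi> \<Gamma>, \<delta>)] (\<Gamma>, \<delta>)"

inductive arith_axiom :: "sequent \<Rightarrow> bool" where
  Zero_Succ: "arith_axiom ({||}, Neg (Eq Zero (Succ t)))"
| Succ_inj: "arith_axiom ({|Eq (Succ s) (Succ t)|}, Eq s t)"
| Plus_Zero: "arith_axiom ({||}, Eq (Plus s Zero) s)"
| Plus_Succ: "arith_axiom ({||}, Eq (Plus s (Succ t)) (Succ (Plus s t)))"
| Times_Zero: "arith_axiom ({||}, Eq (Times s Zero) Zero)"
| Times_Succ: "arith_axiom ({||}, Eq (Times s (Succ t)) (Plus (Times s t) s))"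


section \<open>Cyclic Heyting arithmetic\<close>

text \<open>Only \<open>Case\<close> matters for the proof condition, so the other rules are tagged by their group.\<close>

datatype rule = Logical | Identity | Arith | Case var

inductive cha_rule :: "rule \<Rightarrow> sequent list \<Rightarrow> sequent \<Rightarrow> bool" where
  Logical: "logical_rule E Ps S \<Longrightarrow> cha_rule Logical Ps S"
| Identity: "cha_rule Identity [] (finsert \<delta> \<Gamma>, \<delta>)"
| Arith: "arith_axiom S \<Longrightarrow> cha_rule Arith [] S"
| Case: "cha_rule (Case x)
    [subst_seq (Var(x := Zero)) S, subst_seq (Var(x := Succ (Var x))) S] S"

text \<open>A node is the list of child positions leading to it from the root \<open>[]\<close>.\<close>

type_synonym node = "nat list"

record preproof =
  nodes :: "node set"
  seq_of :: "node \<Rightarrow> sequent"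
  rule_of :: "node \<Rightarrow> rule"
  companion :: "node \<rightharpoonup> node"

text \<open>In a pre-proof, \<open>rule_of P p\<close> has no meaning when \<open>p\<close> is a bud. The number of children of
  a non-bud node is determined by its rule instance.\<close>

definition is_preproof :: "preproof \<Rightarrow> bool" where
  "is_preproof P \<longleftrightarrow>
     finite (nodes P) \<and> [] \<in> nodes P \<and>
     (\<forall>p i. p @ [i] \<in> nodes P \<longrightarrow> p \<in> nodes P) \<and>
     dom (companion P) \<subseteq> nodes P \<and>
     (\<forall>p\<in>nodes P. case companion P p of
        Some q \<Rightarrow>
          (\<forall>i. p @ [i] \<notin> nodes P) \<and>
          q \<in> nodes P \<and> (\<exists>i. q @ [i] \<in> nodes P) \<and>
          seq_of P p = seq_of P q
      | None \<Rightarrow>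
          (\<exists>Ps. cha_rule (rule_of P p) Ps (seq_of P p) \<and>
             (\<forall>i. p @ [i] \<in> nodes P \<longleftrightarrow> i < length Ps) \<and>
             (\<forall>i<length Ps. seq_of P (p @ [i]) = Ps ! i)))"

definition infinite_branch :: "preproof \<Rightarrow> (nat \<Rightarrow> node) \<Rightarrow> bool" where
  "infinite_branch P b \<longleftrightarrow>
     b 0 = [] \<and>
     (\<forall>n. case companion P (b n) of
        Some q \<Rightarrow> b (Suc n) = q
      | None \<Rightarrow> (\<exists>i. b (Suc n) = b n @ [i] \<and> b n @ [i] \<in> nodes P))"

definition is_cha_proof :: "preproof \<Rightarrow> bool" where
  "is_cha_proof P \<longleftrightarrow>
     is_preproof P \<and>
     (\<forall>b. infinite_branch P b \<longrightarrow>
        (\<exists>x. (\<exists>m. \<forall>n\<ge>m. x \<in> fv_seq (seq_of P (b n))) \<and>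
             (\<exists>\<^sub>\<infinity>n. companion P (b n) = None \<and> rule_of P (b n) = Case x)))"

definition cha_provable :: "sequent \<Rightarrow> bool" where
  "cha_provable S \<longleftrightarrow> (\<exists>P. is_cha_proof P \<and> seq_of P [] = S)"


section \<open>Stack-labelled Heyting arithmetic\<close>

datatype sign = Neg_sign | Pos_sign

text \<open>\<open>Label x Neg_sign S\<close> and \<open>Label x Pos_sign S\<close> are the labels \<open>x\<^sup>- \<mapsto> S\<close> and \<open>x\<^sup>+ \<mapsto> S\<close>.\<close>

datatype label = Label (label_var: var) (label_sign: sign) (label_seq: sequent)

type_synonym stack = "label list"

text \<open>The side condition on labels, \<open>x \<in> FV(\<Gamma>, \<delta>)\<close>, is not enforced by the type.\<close>

definition is_stack :: "stack \<Rightarrow> bool" where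
  "is_stack \<Lambda> \<longleftrightarrow> (\<forall>l\<in>set \<Lambda>. label_var l \<in> fv_seq (label_seq l))"

definition Vars :: "stack \<Rightarrow> var set" where
  "Vars \<Lambda> = label_var ` set \<Lambda>"

text \<open>All variables occurring free in a stack, including those of the sequents in its labels.\<close>

definition occ_stack :: "stack \<Rightarrow> var set" where
  "occ_stack \<Lambda> = Vars \<Lambda> \<union> (\<Union>l\<in>set \<Lambda>. fv_seq (label_seq l))"

definition raise :: "var \<Rightarrow> stack \<Rightarrow> stack" where
  "raise x \<Lambda> = map (\<lambda>l. if label_var l = x then Label x Pos_sign (label_seq l) else l) \<Lambda>"

definition well_formed :: "stack \<Rightarrow> sequent \<Rightarrow> bool" where
  "well_formed \<Lambda> S \<longleftrightarrow> is_stack \<Lambda> \<and> Vars \<Lambda> \<subseteq> fv_seq S"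

text \<open>\<open>sha \<Lambda> S\<close>: the sequent \<open>\<Lambda> | S\<close> is derivable. Only \<open>Pop\<close> may have a conclusion that is not
  well-formed; for \<open>Identity\<close> and \<open>Arith\<close> well-formedness is trivial.\<close>

inductive sha :: "stack \<Rightarrow> sequent \<Rightarrow> bool" where
  Logical: "logical_rule E Ps S \<Longrightarrow> E \<inter> occ_stack \<Lambda> = {} \<Longrightarrow> (\<forall>P\<in>set Ps. sha \<Lambda> P) \<Longrightarrow>
    well_formed \<Lambda> S \<Longrightarrow> sha \<Lambda> S"
| Identity: "sha [] (finsert \<delta> \<Gamma>, \<delta>)"
| Arith: "arith_axiom (\<Delta>, \<delta>) \<Longrightarrow> sha [] (\<Gamma> |\<union>| \<Delta>, \<delta>)"
| Comp: "sha (\<Lambda> @ [Label x Neg_sign S]) S \<Longrightarrow> x \<in> fv_seq S \<Longrightarrow> well_formed \<Lambda> S \<Longrightarrow> sha \<Lambda> S"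
| Bud: "well_formed (\<Lambda> @ [Label x Pos_sign S]) S \<Longrightarrow> sha (\<Lambda> @ [Label x Pos_sign S]) S"
| Pop: "sha \<Lambda> S \<Longrightarrow> is_stack (\<Lambda> @ \<Lambda>') \<Longrightarrow> sha (\<Lambda> @ \<Lambda>') S"
| Case: "sha \<Lambda> (subst_seq (Var(x := Zero)) S) \<Longrightarrow>
    sha (raise x \<Lambda>) (subst_seq (Var(x := Succ (Var x))) S) \<Longrightarrow>
    well_formed \<Lambda> S \<Longrightarrow> sha \<Lambda> S"

definition sha_provable :: "sequent \<Rightarrow> bool" where
  "sha_provable S \<longleftrightarrow> sha [] S"

end

theory Submission imports Defs begin

text \<open>
  If the root sequent is not derivable in SHA, then one can follow underivable labelled sequents
  along an infinite branch of the cyclic proof. At each sequent \<open>S\<close> of the branch the stack is first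
  popped down to the labels below the first one whose variable is not free in \<open>S\<close>; then
  \<open>y\<^sup>- \<mapsto> S\<close> is pushed by Comp, where \<open>y\<close> is the variable that has been free for the longest time
  among those for which the stack has no label \<open>y\<^sup>\<plusminus> \<mapsto> S\<close>; finally an underivable premise is
  chosen. Let \<open>x\<close> be the variable that progresses along the branch, \<open>k\<close> the limit inferior of the
  heights of the popped stacks, and \<open>S\<close> a sequent that occurs infinitely often at height \<open>k\<close>.
  If the lowest \<open>k\<close> labels, which are eventually fixed up to signs, include one for \<open>x\<close> and \<open>S\<close>, then
  the case rule for \<open>x\<close> makes it positive and the next visit of \<open>S\<close> is closed by Bud. Otherwise a
  variable at least as old as \<open>x\<close> is pushed at position \<open>k\<close>; it stays free, so that label is never
  popped. Both are impossible.
\<close>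

section \<open>Substitution in SHA\<close>

lemma finite_fv_tm: "finite (fv_tm t)"
  by (induction t) auto

lemma finite_fv: "finite (fv \<phi>)"
proof (induction \<phi>)
  case (All \<phi>)
  then have "finite (Suc -` fv \<phi>)" by (simp add: finite_vimageI)
  then show ?case by (simp add: vimage_def)
next
  case (Ex \<phi>)
  then have "finite (Suc -` fv \<phi>)" by (simp add: finite_vimageI)
  then show ?case by (simp add: vimage_def)
qed (auto simp: finite_fv_tm)

lemma finite_fv_seq: "finite (fv_seq S)"
  by (simp add: fv_seq_def finite_fv)

lemma finite_occ_stack: "finite (occ_stack \<Lambda>)"
  by (simp add: occ_stack_def Vars_def finite_fv_seq)

lemma subst_tm_cong: "(\<And>x. x \<in> fv_tm t \<Longrightarrow> \<sigma> x = \<tau> x) \<Longrightarrow> subst_tm \<sigma> t = subst_tm \<tau> t"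
  by (induction t) auto

lemma subst_cong: "(\<And>x. x \<in> fv \<phi> \<Longrightarrow> \<sigma> x = \<tau> x) \<Longrightarrow> subst \<sigma> \<phi> = subst \<tau> \<phi>"
proof (induction \<phi> arbitrary: \<sigma> \<tau>)
  case (Eq s t)
  then show ?case by (auto intro!: subst_tm_cong)
next
  case (All \<phi>)
  have "subst (lift \<sigma>) \<phi> = subst (lift \<tau>) \<phi>"
    by (rule All.IH) (use All.prems in \<open>auto simp: lift_def split: nat.split\<close>)
  then show ?case by simp
next
  case (Ex \<phi>)
  have "subst (lift \<sigma>) \<phi> = subst (lift \<tau>) \<phi>"
    by (rule Ex.IH) (use Ex.prems in \<open>auto simp: lift_def split: nat.split\<close>)
  then show ?case by simp
next
  case (And \<phi> \<psi>)
  then show ?case by (metis UnCI fv.simps(3) subst.simps(3))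
next
  case (Or \<phi> \<psi>)
  then show ?case by (metis UnCI fv.simps(4) subst.simps(4))
next
  case (Imp \<phi> \<psi>)
  then show ?case by (metis UnCI fv.simps(5) subst.simps(5))
qed simp

lemma subst_tm_Var: "subst_tm Var t = t"
  by (induction t) auto

lemma lift_Var: "lift Var = Var"
  by (rule ext) (simp add: lift_def split: nat.split)

lemma subst_Var: "subst Var \<phi> = \<phi>"
  by (induction \<phi>) (auto simp: subst_tm_Var lift_Var)

lemma subst_seq_cong:
  assumes "\<And>x. x \<in> fv_seq S \<Longrightarrow> \<sigma> x = \<tau> x"
  shows "subst_seq \<sigma> S = subst_seq \<tau> S"
proof -
  have "subst \<sigma> \<phi> = subst \<tau> \<phi>" if "\<phi> |\<in>| fst S \<or> \<phi> = snd S" for \<phi>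
    by (rule subst_cong) (use that assms in \<open>auto simp: fv_seq_def\<close>)
  then show ?thesis by (auto simp: subst_seq_def intro!: fset.map_cong0)
qed

lemma subst_seq_Var: "subst_seq Var S = S"
  by (simp add: subst_seq_def subst_Var prod_eq_iff fset.map_ident_strong)

lemma fv_subst_seq: "fv_seq (subst_seq \<sigma> S) = (\<Union>x\<in>fv_seq S. fv_tm (\<sigma> x))"
  by (auto simp: fv_seq_def subst_seq_def fv_subst)

text \<open>Substitution of a variable is an instance of \<open>=L\<close> with two equal terms: the hypothesis
  \<open>y' = y'\<close> is then cut against \<open>=R\<close>.\<close>

lemma sha_rename:
  assumes "sha \<Lambda> S" and wf: "well_formed \<Lambda> S" and y: "y \<notin> Vars \<Lambda>" and ne: "y' \<noteq> y"
  shows "sha \<Lambda> (subst_seq (Var(y := Var y')) S)"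
proof -
  obtain \<Gamma> \<delta> where S: "S = (\<Gamma>, \<delta>)" by (cases S)
  \<comment> \<open>\<open>EqL\<close> replaces two distinct variables. The second one is taken
    fresh for \<open>S\<close>, so its replacement changes nothing and the premise is
    \<open>S\<close> itself.\<close>
  obtain z where z: "z \<notin> fv_seq S \<union> {y, y'}"
    using ex_new_if_finite[OF infinite_UNIV_nat, of "fv_seq S \<union> {y, y'}"]
    by (auto simp: finite_fv_seq)
  obtain \<Gamma>' \<delta>' where S': "subst_seq (Var(y := Var y')) S = (\<Gamma>', \<delta>')" by fastforce
  let ?e = "Eq (Var y') (Var y')"
  have is_st: "is_stack \<Lambda>" using wf by (simp add: well_formed_def)
  have "subst_seq (Var(y := Var y', z := Var y')) S = subst_seq (Var(y := Var y')) S"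
    by (rule subst_seq_cong) (use z in auto)
  then have concl: "subst (Var(y := Var y', z := Var y')) |`| \<Gamma> = \<Gamma>'"
    "subst (Var(y := Var y', z := Var y')) \<delta> = \<delta>'"
    using S' by (auto simp: S subst_seq_def)
  have "subst_seq (Var(z := Var y)) S = subst_seq Var S"
    by (rule subst_seq_cong) (use z in auto)
  then have prem: "subst_seq (Var(z := Var y)) (\<Gamma>, \<delta>) = S"
    by (simp add: subst_seq_Var S)
  have rule: "logical_rule {} [S] (finsert ?e \<Gamma>', \<delta>')"
    using EqL[of y z "Var y'" "Var y'" \<Gamma> \<delta>] z ne unfolding prem concl by auto
  have "Vars \<Lambda> \<subseteq> fv_seq (\<Gamma>', \<delta>')"
    using wf y by (auto simp: well_formed_def S'[symmetric] fv_subst_seq)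
  then have wf': "well_formed \<Lambda> (\<Gamma>', \<delta>')" "well_formed \<Lambda> (finsert ?e \<Gamma>', \<delta>')"
    using is_st by (auto simp: well_formed_def fv_seq_def)
  \<comment> \<open>Replacing the succedent by \<open>?e\<close> may lose free variables that
    \<open>\<Lambda>\<close> needs, so the equation is derived over the empty stack and
    \<open>\<Lambda>\<close> is restored by Pop.\<close>
  have "sha [] (\<Gamma>', ?e)"
    by (rule sha.Logical[OF EqR]) (auto simp: well_formed_def is_stack_def Vars_def)
  then have 1: "sha \<Lambda> (\<Gamma>', ?e)"
    using sha.Pop[of "[]" _ \<Lambda>] is_st by simp
  have 2: "sha \<Lambda> (finsert ?e \<Gamma>', \<delta>')"
    by (rule sha.Logical[OF rule]) (use assms(1) wf' in auto)
  show ?thesis unfolding S'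
    by (rule sha.Logical[OF Cut[of _ ?e]]) (use 1 2 wf' in auto)
qed

lemma inst_rename:
  assumes "y \<notin> fv (All \<phi>)"
  shows "subst (Var(y := Var y')) (inst (Var y) \<phi>) = inst (Var y') \<phi>"
  unfolding inst_def subst_subst
  by (rule subst_cong) (use assms in \<open>auto split: nat.split\<close>)

lemma fv_inst_Var: "fv (All \<phi>) \<subseteq> fv (inst t \<phi>)"
  by (force simp: inst_def fv_subst)

lemma subst_fresh: "y \<notin> fv \<phi> \<Longrightarrow> subst (Var(y := t)) \<phi> = \<phi>"
  by (subst subst_cong[where \<tau> = Var]) (auto simp: subst_Var)

lemma image_subst_fresh:
  assumes "\<And>\<phi>. \<phi> |\<in>| \<Gamma> \<Longrightarrow> y \<notin> fv \<phi>"
  shows "subst (Var(y := t)) |`| \<Gamma> = \<Gamma>"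
  by (rule fset.map_ident_strong) (use assms in \<open>auto intro: subst_fresh\<close>)

text \<open>An eigenvariable occurring in the stack does not occur among its label variables, because the
  conclusion is well-formed; so it can be renamed to a fresh one.\<close>

lemma sha_logical:
  assumes "logical_rule E Ps S" and wf: "well_formed \<Lambda> S" and prems: "\<forall>P\<in>set Ps. sha \<Lambda> P"
  shows "sha \<Lambda> S"
proof -
  \<comment> \<open>Avoiding \<open>E\<close> makes the new eigenvariable differ from the old one,
    as \<open>sha_rename\<close> requires.\<close>
  define Y where "Y = occ_stack \<Lambda> \<union> fv_seq S \<union> E"
  have "E = {} \<or> (\<exists>y y'. E = {y} \<and> y' \<notin> Y)"
  proof -
    have "E = {} \<or> (\<exists>y. E = {y})" using assms(1) by cases auto
    moreover have "finite Y" if "E = {y}" for y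
      using that by (simp add: Y_def finite_occ_stack finite_fv_seq)
    ultimately show ?thesis using ex_new_if_finite[OF infinite_UNIV_nat] by blast
  qed
  then consider "E = {}" | y y' where "E = {y}" "y' \<notin> Y" by blast
  then show ?thesis
  proof cases
    case 1
    then show ?thesis using sha.Logical[OF assms(1) _ prems wf] by simp
  next
    case (2 y y')
    have ne: "y' \<noteq> y" and fresh: "y' \<notin> occ_stack \<Lambda>" "y' \<notin> fv_seq S"
      using 2 by (auto simp: Y_def)
    show ?thesis using assms(1)
    proof cases
      case (AllR z \<Gamma> \<phi>)
      then have z: "z = y" using 2 by simp
      have y: "y \<notin> fv_seq S" using AllR z by simp
      let ?P = "(\<Gamma>, inst (Var y) \<phi>)"
      have "Vars \<Lambda> \<subseteq> fv_seq S" using wf by (simp add: well_formed_def)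
      also have "fv_seq S \<subseteq> fv_seq ?P"
        using fv_inst_Var[of \<phi> "Var y"] by (auto simp: AllR fv_seq_def)
      finally have "well_formed \<Lambda> ?P" using wf by (simp add: well_formed_def)
      then have "sha \<Lambda> (subst_seq (Var(y := Var y')) ?P)"
        using prems wf y ne AllR z by (intro sha_rename) (auto simp: well_formed_def)
      moreover have "subst_seq (Var(y := Var y')) ?P = (\<Gamma>, inst (Var y') \<phi>)"
        using y inst_rename[of y \<phi> y'] image_subst_fresh[of \<Gamma> y "Var y'"]
        by (auto simp: subst_seq_def AllR fv_seq_def)
      ultimately show ?thesis
        using sha.Logical[OF logical_rule.AllR[of y' \<Gamma> \<phi>]] fresh wf AllR by simp
    next
      case (ExL z \<phi> \<Gamma> \<delta>)
      then have z: "z = y" using 2 by simp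
      have y: "y \<notin> fv_seq S" using ExL z by simp
      let ?P = "(finsert (inst (Var y) \<phi>) \<Gamma>, \<delta>)"
      have "Vars \<Lambda> \<subseteq> fv_seq S" using wf by (simp add: well_formed_def)
      also have "fv_seq S \<subseteq> fv_seq ?P"
        using fv_inst_Var[of \<phi> "Var y"] by (auto simp: ExL fv_seq_def)
      finally have "well_formed \<Lambda> ?P" using wf by (simp add: well_formed_def)
      then have "sha \<Lambda> (subst_seq (Var(y := Var y')) ?P)"
        using prems wf y ne ExL z by (intro sha_rename) (auto simp: well_formed_def)
      moreover have "subst_seq (Var(y := Var y')) ?P = (finsert (inst (Var y') \<phi>) \<Gamma>, \<delta>)"
        using y inst_rename[of y \<phi> y'] image_subst_fresh[of \<Gamma> y "Var y'"]
          subst_fresh[of y \<delta> "Var y'"]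
        by (auto simp: subst_seq_def ExL fv_seq_def)
      ultimately show ?thesis
        using sha.Logical[OF logical_rule.ExL[of y' \<phi> \<Gamma> \<delta>]] fresh wf ExL by simp
    qed (use 2 in auto)
  qed
qed


section \<open>Runs of the stack\<close>

text \<open>Signs are left out because \<open>raise\<close> changes nothing else: keys are what
  persists along a run.\<close>

definition key :: "label \<Rightarrow> var \<times> sequent" where
  "key l = (label_var l, label_seq l)"

lemma key_Label: "key (Label x s S) = (x, S)"
  by (simp add: key_def)

text \<open>Pop removes only a final segment, so everything above the first label whose variable is
  not free has to go with it.\<close>

definition pop_stack :: "sequent \<Rightarrow> stack \<Rightarrow> stack" where
  "pop_stack S \<Lambda> = takeWhile (\<lambda>l. label_var l \<in> fv_seq S) \<Lambda>"

text \<open>Here \<open>a\<close> gives the ages. Only absent keys are added, which keeps the keys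
  of a stack distinct. Ties in age leave a choice, hence a relation.\<close>

inductive push :: "(var \<Rightarrow> nat) \<Rightarrow> sequent \<Rightarrow> stack \<Rightarrow> stack \<Rightarrow> bool" for a S \<Lambda> where
  keep: "(\<And>x. x \<in> fv_seq S \<Longrightarrow> (x, S) \<in> key ` set \<Lambda>) \<Longrightarrow> push a S \<Lambda> \<Lambda>"
| add: "x \<in> fv_seq S \<Longrightarrow> (x, S) \<notin> key ` set \<Lambda> \<Longrightarrow>
    (\<And>y. y \<in> fv_seq S \<Longrightarrow> (y, S) \<notin> key ` set \<Lambda> \<Longrightarrow> a y \<le> a x) \<Longrightarrow>
    push a S \<Lambda> (\<Lambda> @ [Label x Neg_sign S])"

lemma push_exists: "\<exists>\<Lambda>'. push a S \<Lambda> \<Lambda>'"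
proof -
  let ?M = "{x \<in> fv_seq S. (x, S) \<notin> key ` set \<Lambda>}"
  have fin: "finite ?M" using finite_fv_seq by simp
  show ?thesis
  proof (cases "?M = {}")
    case True
    then have "push a S \<Lambda> \<Lambda>" by (intro push.keep) blast
    then show ?thesis by blast
  next
    case False
    then have "Max (a ` ?M) \<in> a ` ?M" using fin by (intro Max_in) blast+
    then obtain x where max: "Max (a ` ?M) = a x" and "x \<in> ?M" by (rule imageE)
    moreover have "a y \<le> a x" if "y \<in> ?M" for y
      unfolding max[symmetric] using that fin by simp
    ultimately have "push a S \<Lambda> (\<Lambda> @ [Label x Neg_sign S])" by (intro push.add) auto
    then show ?thesis by blast
  qed
qed

lemma map_key_raise: "map key (raise x \<Lambda>) = map key \<Lambda>"
  by (simp add: raise_def key_def)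

lemma pop_stack_prefix: "\<exists>\<Lambda>'. \<Lambda> = pop_stack S \<Lambda> @ \<Lambda>'"
  unfolding pop_stack_def by (metis takeWhile_dropWhile_id)

text \<open>\<open>age n x\<close> is the number of steps for which \<open>x\<close> has been continuously free, \<open>stk n\<close> and
  \<open>full n\<close> are the stacks before popping and after pushing at step \<open>n\<close>, and \<open>cs n x\<close> says that
  step \<open>n\<close> is an instance of the case rule for \<open>x\<close>.\<close>

locale stack_run =
  fixes seq :: "nat \<Rightarrow> sequent" and age :: "nat \<Rightarrow> var \<Rightarrow> nat"
    and stk full :: "nat \<Rightarrow> stack" and cs :: "nat \<Rightarrow> var \<Rightarrow> bool"
  assumes finite_seq: "finite (range seq)"
    and age_Suc: "age (Suc n) x = (if x \<in> fv_seq (seq (Suc n)) then Suc (age n x) else 0)"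
    and stk_0: "stk 0 = []"
    and push: "push (age n) (seq n) (pop_stack (seq n) (stk n)) (full n)"
    and stk_Suc: "stk (Suc n) = full n \<or> (\<exists>x. stk (Suc n) = raise x (full n))"
    and stk_case: "cs n x \<Longrightarrow> x \<in> fv_seq (seq (Suc n)) \<Longrightarrow> stk (Suc n) = raise x (full n)"
    and not_closed: "Label x Pos_sign (seq n) \<notin> set (pop_stack (seq n) (stk n))"
begin

abbreviation popped :: "nat \<Rightarrow> stack" where
  "popped n \<equiv> pop_stack (seq n) (stk n)"

text \<open>Measured after popping and before pushing, so the positions below it hold exactly the
  old labels that survive step \<open>n\<close>.\<close>

abbreviation height :: "nat \<Rightarrow> nat" where
  "height n \<equiv> length (popped n)"

abbreviation free :: "nat \<Rightarrow> var set" where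
  "free n \<equiv> fv_seq (seq n)"

section \<open>Labels below the height during one step\<close>

lemma map_key_stk_Suc: "map key (stk (Suc n)) = map key (full n)"
  using stk_Suc[of n] by (auto simp: map_key_raise)

lemma stk_popped: "i < height n \<Longrightarrow> stk n ! i = popped n ! i"
  by (metis pop_stack_prefix nth_append)

lemma full_popped: "i < height n \<Longrightarrow> full n ! i = popped n ! i"
  using push[of n] by cases (auto simp: nth_append)

lemma height_le_full: "height n \<le> length (full n)"
  using push[of n] by cases auto

lemma length_stk_Suc: "length (stk (Suc n)) = length (full n)"
  using map_key_stk_Suc map_eq_imp_length_eq by blast

lemma key_stk_Suc: "i < height n \<Longrightarrow> key (stk (Suc n) ! i) = key (stk n ! i)"
  by (metis map_key_stk_Suc nth_map length_stk_Suc height_le_full less_le_trans stk_popped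
      full_popped)

lemma sign_stk_Suc:
  assumes "i < height n" "label_sign (stk n ! i) = Pos_sign"
  shows "label_sign (stk (Suc n) ! i) = Pos_sign"
proof -
  have "i < length (full n)" using assms(1) height_le_full[of n] by simp
  then show ?thesis
    using stk_Suc[of n] assms stk_popped[of i n] full_popped[of i n] by (auto simp: raise_def)
qed

lemma sign_stk_case:
  assumes "i < height n" "label_var (stk n ! i) = x" "cs n x" "x \<in> free (Suc n)"
  shows "label_sign (stk (Suc n) ! i) = Pos_sign"
proof -
  have "i < length (full n)" using assms(1) height_le_full[of n] by simp
  then show ?thesis
    using stk_case[OF assms(3,4)] assms stk_popped[of i n] full_popped[of i n]
    by (auto simp: raise_def)
qed

lemma height_gt:
  assumes "k \<le> height n" "k < length (stk n)" "label_var (stk n ! k) \<in> free n"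
  shows "k < height n"
proof (rule ccontr)
  assume "\<not> k < height n"
  then have "k = height n" using assms(1) by simp
  then show False
    using assms(2,3) nth_length_takeWhile unfolding pop_stack_def by fastforce
qed

section \<open>Boundedness of the heights\<close>

definition keys :: "(var \<times> sequent) set" where
  "keys = (SIGMA x:(\<Union>S\<in>range seq. fv_seq S). range seq)"

lemma finite_keys: "finite keys"
  unfolding keys_def using finite_seq finite_fv_seq by (intro finite_SigmaI finite_UN_I) auto

text \<open>Popping keeps a prefix, pushing adds only a new key, and raising leaves keys alone.
  Distinct keys from a finite set bound the length of the stack.\<close>

lemma keys_stk: "distinct (map key (stk n)) \<and> key ` set (stk n) \<subseteq> keys"
proof (induction n)
  case 0
  then show ?case by (simp add: stk_0)
next
  case (Suc n)
  obtain \<Lambda>' where "stk n = popped n @ \<Lambda>'" using pop_stack_prefix by blast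
  then have "map key (stk n) = map key (popped n) @ map key \<Lambda>'" by (metis map_append)
  then have "distinct (map key (popped n)) \<and> set (map key (popped n)) \<subseteq> keys"
    using Suc by (metis distinct_append le_sup_iff set_append set_map)
  moreover have "(x, seq n) \<in> keys" if "x \<in> free n" for x
    using that by (auto simp: keys_def)
  ultimately have "distinct (map key (full n)) \<and> set (map key (full n)) \<subseteq> keys"
    using push[of n] by (auto elim!: push.cases simp: key_Label image_subset_iff)
  then show ?case by (metis map_key_stk_Suc set_map)
qed

lemma height_bound: "height n \<le> card keys"
proof -
  have "height n \<le> length (stk n)"
    by (simp add: pop_stack_def length_takeWhile_le)
  also have "\<dots> = card (key ` set (stk n))"
    using keys_stk[of n] by (metis distinct_card length_map set_map)
  also have "\<dots> \<le> card keys"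
    using keys_stk[of n] finite_keys card_mono by blast
  finally show ?thesis .
qed

section \<open>Comparison of ages\<close>

lemma age_free:
  assumes "\<And>n. n \<ge> m \<Longrightarrow> x \<in> free n"
  shows "n \<ge> m \<Longrightarrow> n - m \<le> age n x"
proof (induction n)
  case (Suc n)
  then show ?case
    using age_Suc[of n x] assms[of "Suc n"] by (cases "n \<ge> m") (auto simp: not_le le_Suc_eq)
qed simp

text \<open>The age is reset to 0 at \<open>j\<close> and grows by at most one per step. Position 0
  is excluded because the locale leaves the initial ages arbitrary.\<close>

lemma age_not_free:
  assumes "x \<notin> free j" "j > 0"
  shows "n \<ge> j \<Longrightarrow> age n x \<le> n - j"
proof (induction n rule: dec_induct)
  case base
  obtain i where "j = Suc i" using assms(2) gr0_implies_Suc by blast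
  then show ?case using assms(1) age_Suc[of i x] by simp
next
  case (step n)
  then show ?case using age_Suc[of n x] by auto
qed

text \<open>Eventually every variable at least as old as a persistently free one is itself
  persistently free; this is why pushing the oldest variable first works.\<close>

lemma older_free:
  assumes x: "\<And>n. n \<ge> m \<Longrightarrow> x \<in> free n"
  obtains M where "\<And>n y j. M \<le> n \<Longrightarrow> y \<in> free n \<Longrightarrow> age n x \<le> age n y \<Longrightarrow> n \<le> j \<Longrightarrow> y \<in> free j"
proof -
  have "\<forall>\<^sub>F M in sequentially. (\<forall>n\<ge>M. y \<in> free n) \<or> (\<forall>n\<ge>M. age n y < age n x)" for y
  proof (cases "\<exists>M. \<forall>n\<ge>M. y \<in> free n")
    case True
    then obtain M where "\<And>n. n \<ge> M \<Longrightarrow> y \<in> free n" by blast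
    then show ?thesis
      by (intro eventually_sequentiallyI[of M]) auto
  next
    case False
    \<comment> \<open>Since \<open>j > m\<close>, the count for \<open>y\<close> restarts strictly
      later than the uninterrupted count for \<open>x\<close>, so \<open>y\<close> stays younger
      even if it becomes free again.\<close>
    then obtain j where j: "j \<ge> Suc m" "y \<notin> free j" by blast
    have "age n y < age n x" if "n \<ge> j" for n
    proof -
      have "age n y \<le> n - j" using age_not_free[OF j(2), of n] that j by simp
      also have "\<dots> < n - m" using that j by simp
      also have "\<dots> \<le> age n x" using age_free[where m = m and x = x and n = n] x that j by simp
      finally show ?thesis .
    qed
    then show ?thesis by (intro eventually_sequentiallyI[of j]) auto
  qed
  \<comment> \<open>Only finitely many variables occur in the run, so one threshold serves them
    all.\<close>
  moreover have fin: "finite (\<Union>S\<in>range seq. fv_seq S)"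
    using finite_seq finite_fv_seq by (intro finite_UN_I) auto
  ultimately have "\<forall>\<^sub>F M in sequentially. \<forall>y\<in>(\<Union>S\<in>range seq. fv_seq S).
      (\<forall>n\<ge>M. y \<in> free n) \<or> (\<forall>n\<ge>M. age n y < age n x)"
    by (simp only: eventually_ball_finite_distrib[OF fin]) blast
  then obtain M where M: "\<And>y. y \<in> (\<Union>S\<in>range seq. fv_seq S) \<Longrightarrow>
      (\<forall>n\<ge>M. y \<in> free n) \<or> (\<forall>n\<ge>M. age n y < age n x)"
    using eventually_happens'[OF sequentially_bot] by blast
  show ?thesis
  proof (rule that)
    fix n y j assume "M \<le> n" "y \<in> free n" "age n x \<le> age n y" "n \<le> j"
    then show "y \<in> free j" using M[of y] by (force simp: not_less)
  qed
qed

section \<open>Contradiction at the limit inferior of the heights\<close>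

lemma no_progress:
  assumes x: "\<And>n. n \<ge> m \<Longrightarrow> x \<in> free n" and cs: "\<exists>\<^sub>\<infinity>n. cs n x"
  shows False
proof -
  \<comment> \<open>Bounded heights make some value recur infinitely often. Smaller values than the
    least such \<open>k\<close> occur only finitely often, so the height is eventually at least
    \<open>k\<close>.\<close>
  define k where "k = (LEAST k. \<exists>\<^sub>\<infinity>n. height n = k)"
  have "finite (height ` UNIV)"
    by (rule finite_subset[of _ "{..card keys}"]) (use height_bound in auto)
  then have "\<exists>k. \<exists>\<^sub>\<infinity>n. height n = k"
    using pigeonhole_infinite[of "UNIV :: nat set" height] by (auto simp: frequently_cofinite)
  then have inf_k: "\<exists>\<^sub>\<infinity>n. height n = k"
    unfolding k_def by (rule LeastI_ex)
  have "\<forall>\<^sub>\<infinity>n. height n \<noteq> j" if "j < k" for j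
    using not_less_Least[OF that[unfolded k_def]] by (simp add: not_INFM)
  then have "\<forall>\<^sub>\<infinity>n. \<forall>j\<in>{..<k}. height n \<noteq> j"
    by (subst eventually_ball_finite_distrib) auto
  then obtain N where N: "\<And>n. n \<ge> N \<Longrightarrow> k \<le> height n"
    unfolding MOST_nat_le by (metis lessThan_iff not_less)
  have "infinite {n. height n = k}" using inf_k by (simp add: frequently_cofinite)
  moreover have "finite (seq ` {n. height n = k})"
    using finite_seq by (rule finite_subset[rotated]) auto
  ultimately obtain n0 where "infinite {n \<in> {n. height n = k}. seq n = seq n0}"
    using pigeonhole_infinite by blast
  then have inf_S: "\<exists>\<^sub>\<infinity>n. height n = k \<and> seq n = seq n0"
    by (simp add: frequently_cofinite)
  obtain M where older: "\<And>n y j. M \<le> n \<Longrightarrow> y \<in> free n \<Longrightarrow> age n x \<le> age n y \<Longrightarrow> n \<le> j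
      \<Longrightarrow> y \<in> free j"
    using older_free[OF x] by blast
  \<comment> \<open>From \<open>n1\<close> on, no height is below \<open>k\<close>,
    \<open>older\<close> applies and \<open>x\<close> is free.\<close>
  obtain n1 where n1: "n1 \<ge> max (max N M) m" "height n1 = k" "seq n1 = seq n0"
    using inf_S unfolding INFM_nat_le by blast
  have stable: "key (stk n ! i) = key (stk n1 ! i)" if "i < k" "n \<ge> n1" for i n
    using that(2)
  proof (induction n rule: dec_induct)
    case (step n)
    then show ?case using key_stk_Suc[of i n] N[of n] n1 \<open>i < k\<close> by simp
  qed simp
  show False
  proof (cases "(x, seq n0) \<in> key ` set (popped n1)")
    case True
    then obtain i where i: "i < k" and "key (popped n1 ! i) = (x, seq n0)"
      using n1(2) by (metis image_iff in_set_conv_nth)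
    then have key_i: "key (stk n ! i) = (x, seq n0)" if "n \<ge> n1" for n
      using stable[of i n] stk_popped[of i n1] n1(2) that by simp
    obtain n2 where n2: "n2 \<ge> n1" "cs n2 x"
      using cs unfolding INFM_nat_le by blast
    have h: "i < height n" if "n \<ge> n1" for n using N[of n] n1 i that by simp
    \<comment> \<open>The case rule at \<open>n2\<close> makes the label at \<open>i\<close>
      positive. It lies below every later height, so it is neither popped nor made negative
      again.\<close>
    have pos: "label_sign (stk n ! i) = Pos_sign" if "n \<ge> Suc n2" for n
      using that
    proof (induction n rule: dec_induct)
      case base
      show ?case
        using sign_stk_case[OF h[of n2] _ n2(2)] n2 n1 x key_i[of n2] by (simp add: key_def)
    next
      case (step n)
      then show ?case using sign_stk_Suc[of i n] h[of n] n2 by simp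
    qed
    obtain n3 where n3: "n3 \<ge> Suc n2" "seq n3 = seq n0"
      using inf_S unfolding INFM_nat_le by blast
    have "stk n3 ! i = Label x Pos_sign (seq n3)"
      using pos[OF n3(1)] key_i[of n3] n3 n2 by (cases "stk n3 ! i") (auto simp: key_def)
    then have "Label x Pos_sign (seq n3) \<in> set (popped n3)"
      using stk_popped[of i n3] h[of n3] n3 n2 by (metis Suc_leD le_trans nth_mem)
    then show False using not_closed by blast
  next
    case False
    have "x \<in> free n1" using x[of n1] n1(1) by simp
    \<comment> \<open>As \<open>x\<close> is free and its key is absent, \<open>push\<close> must
      add a label, and \<open>x\<close> itself competes for the maximal age.\<close>
    obtain y where y: "y \<in> free n1" "age n1 x \<le> age n1 y"
      and full: "full n1 = popped n1 @ [Label y Neg_sign (seq n1)]"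
      using push[of n1] False \<open>x \<in> free n1\<close> n1(3) by cases auto
    have free_y: "y \<in> free j" if "j \<ge> n1" for j
      using older[of n1 y j] y n1 that by simp
    \<comment> \<open>The label of \<open>y\<close> sits at position \<open>k\<close>. All labels
      below it survive and \<open>y\<close> stays free, so popping never reaches it, contradicting
      the recurrence of height \<open>k\<close>.\<close>
    have above: "k < length (stk n) \<and> label_var (stk n ! k) = y \<and> k < height n"
      if "n \<ge> Suc n1" for n
      using that
    proof (induction n rule: dec_induct)
      case base
      have "k < length (full n1)" using full n1(2) by simp
      then have "key (stk (Suc n1) ! k) = key (full n1 ! k)" and l: "k < length (stk (Suc n1))"
        using map_key_stk_Suc[of n1] length_stk_Suc[of n1] by (metis nth_map)+
      then have "label_var (stk (Suc n1) ! k) = y" using full n1(2) by (auto simp: key_def)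
      then show ?case using l height_gt[of k "Suc n1"] N[of "Suc n1"] free_y n1 by simp
    next
      case (step n)
      then have "label_var (stk (Suc n) ! k) = y"
        using key_stk_Suc[of k n] by (simp add: key_def)
      moreover have "k < length (stk (Suc n))"
        using step height_le_full[of n] length_stk_Suc[of n] by simp
      ultimately show ?case
        using height_gt[of k "Suc n"] N[of "Suc n"] free_y[of "Suc n"] n1 step by simp
    qed
    obtain n where "n \<ge> Suc n1" "height n = k"
      using inf_k unfolding INFM_nat_le by blast
    then show False using above[of n] by simp
  qed
qed

end


section \<open>Unfolding a cyclic proof\<close>

lemma well_formed_pop_stack: "is_stack \<Lambda> \<Longrightarrow> well_formed (pop_stack S \<Lambda>) S"
  by (auto simp: well_formed_def is_stack_def Vars_def pop_stack_def dest: set_takeWhileD)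

lemma well_formed_push:
  assumes "push a S \<Lambda> \<Lambda>'" "well_formed \<Lambda> S"
  shows "well_formed \<Lambda>' S"
  using assms by cases (auto simp: well_formed_def is_stack_def Vars_def)

lemma sha_pop_stack:
  assumes "sha (pop_stack S \<Lambda>) S" "is_stack \<Lambda>"
  shows "sha \<Lambda> S"
  using assms pop_stack_prefix[of \<Lambda> S] by (metis sha.Pop)

lemma sha_push:
  assumes "push a S \<Lambda> \<Lambda>'" "sha \<Lambda>' S" "well_formed \<Lambda> S"
  shows "sha \<Lambda> S"
  using assms by cases (auto intro: sha.Comp)

text \<open>Bud needs the positive label on top; Pop accounts for whatever lies above it.\<close>

lemma sha_bud:
  assumes "well_formed \<Lambda> S" "Label x Pos_sign S \<in> set \<Lambda>"
  shows "sha \<Lambda> S"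
proof -
  obtain \<Lambda>\<^sub>1 \<Lambda>\<^sub>2 where split: "\<Lambda> = (\<Lambda>\<^sub>1 @ [Label x Pos_sign S]) @ \<Lambda>\<^sub>2"
    using assms(2) by (auto simp: in_set_conv_decomp)
  have "well_formed (\<Lambda>\<^sub>1 @ [Label x Pos_sign S]) S"
    using assms(1) by (auto simp: split well_formed_def is_stack_def Vars_def)
  then show ?thesis
    using assms(1) unfolding split well_formed_def by (intro sha.Pop sha.Bud) (auto simp: well_formed_def)
qed

lemma is_stack_raise: "is_stack \<Lambda> \<Longrightarrow> is_stack (raise x \<Lambda>)"
  by (auto simp: is_stack_def raise_def)

text \<open>The zero premise of a case rule leaves the stack unraised, but \<open>x\<close> is
  substituted away there. Hence a premise in which \<open>x\<close> is free is the successor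
  premise.\<close>

lemma unprovable_premise:
  assumes "cha_rule r Ps S" and wf: "well_formed \<Lambda> S" and "\<not> sha \<Lambda> S"
  obtains i \<Lambda>' where "i < length Ps" "\<not> sha \<Lambda>' (Ps ! i)" "\<Lambda>' = \<Lambda> \<or> (\<exists>x. \<Lambda>' = raise x \<Lambda>)"
    "\<And>x. r = Case x \<Longrightarrow> x \<in> fv_seq (Ps ! i) \<Longrightarrow> \<Lambda>' = raise x \<Lambda>"
proof -
  \<comment> \<open>Axioms are available over the empty stack only; Pop supplies all of
    \<open>\<Lambda>\<close>.\<close>
  have pop: "sha \<Lambda> S" if "sha [] S"
    using sha.Pop[OF that] wf by (simp add: well_formed_def)
  show ?thesis using assms(1)
  proof cases
    case (Logical E)
    then obtain P where "P \<in> set Ps" "\<not> sha \<Lambda> P"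
      using sha_logical[OF _ wf] assms(3) by blast
    then obtain i where "i < length Ps" "\<not> sha \<Lambda> (Ps ! i)" by (metis in_set_conv_nth)
    then show ?thesis using that Logical by blast
  next
    case (Identity \<delta> \<Gamma>)
    then show ?thesis using pop sha.Identity assms(3) by blast
  next
    case Arith
    then have "sha [] S" using sha.Arith[of "fst S" "snd S" "{||}"] by simp
    then show ?thesis using pop assms(3) by blast
  next
    case (Case x)
    let ?P0 = "subst_seq (Var(x := Zero)) S" and ?P1 = "subst_seq (Var(x := Succ (Var x))) S"
    consider "\<not> sha \<Lambda> ?P0" | "\<not> sha (raise x \<Lambda>) ?P1"
      using sha.Case wf assms(3) by blast
    then show ?thesis
    proof cases
      case 1
      have "x \<notin> fv_seq ?P0" by (auto simp: fv_subst_seq split: if_splits)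
      then show ?thesis using 1 Case that[of 0 \<Lambda>] by auto
    next
      case 2
      then show ?thesis using Case that[of 1 "raise x \<Lambda>"] by auto
    qed
  qed
qed

section \<open>Following an underivable sequent through the pre-proof\<close>

definition next_node :: "preproof \<Rightarrow> node \<Rightarrow> node \<Rightarrow> bool" where
  "next_node P p p' \<longleftrightarrow> (case companion P p of
     Some q \<Rightarrow> p' = q
   | None \<Rightarrow> (\<exists>i. p' = p @ [i] \<and> p @ [i] \<in> nodes P))"

definition case_at :: "preproof \<Rightarrow> node \<Rightarrow> var \<Rightarrow> bool" where
  "case_at P p x \<longleftrightarrow> companion P p = None \<and> rule_of P p = Case x"

lemma unprovable_next:
  assumes P: "is_preproof P" and p: "p \<in> nodes P"
    and wf: "well_formed \<Lambda> (seq_of P p)" and un: "\<not> sha \<Lambda> (seq_of P p)"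
  obtains p' \<Lambda>' where "p' \<in> nodes P" "next_node P p p'" "\<not> sha \<Lambda>' (seq_of P p')"
    "\<Lambda>' = \<Lambda> \<or> (\<exists>x. \<Lambda>' = raise x \<Lambda>)"
    "\<And>x. case_at P p x \<Longrightarrow> x \<in> fv_seq (seq_of P p') \<Longrightarrow> \<Lambda>' = raise x \<Lambda>"
proof (cases "companion P p")
  case None
  then obtain Ps where rule: "cha_rule (rule_of P p) Ps (seq_of P p)"
    and children: "\<And>i. i < length Ps \<Longrightarrow> p @ [i] \<in> nodes P \<and> seq_of P (p @ [i]) = Ps ! i"
    using P p unfolding is_preproof_def by fastforce
  obtain i \<Lambda>' where "i < length Ps" "\<not> sha \<Lambda>' (Ps ! i)" "\<Lambda>' = \<Lambda> \<or> (\<exists>x. \<Lambda>' = raise x \<Lambda>)"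
    "\<And>x. rule_of P p = Case x \<Longrightarrow> x \<in> fv_seq (Ps ! i) \<Longrightarrow> \<Lambda>' = raise x \<Lambda>"
    using unprovable_premise[OF rule wf un] by blast
  then show ?thesis
    using that[of "p @ [i]" \<Lambda>'] children[of i] None by (simp add: next_node_def case_at_def)
next
  case (Some q)
  then have "q \<in> nodes P" "seq_of P p = seq_of P q"
    using P p unfolding is_preproof_def by fastforce+
  then show ?thesis
    using that[of q \<Lambda>] Some un by (simp add: next_node_def case_at_def)
qed

theorem theorem3p2:
  fixes \<Gamma> :: "fm fset" and \<delta> :: fm
  assumes "cha_provable (\<Gamma>, \<delta>)"
  shows "sha_provable (\<Gamma>, \<delta>)"
proof (rule ccontr)
  assume not_sha: "\<not> sha_provable (\<Gamma>, \<delta>)"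
  obtain P where P: "is_cha_proof P" and root: "seq_of P [] = (\<Gamma>, \<delta>)"
    using assms by (auto simp: cha_provable_def)
  have pre: "is_preproof P" using P by (simp add: is_cha_proof_def)
  \<comment> \<open>A state is a node with ages and the stack before popping. That stack need not be
    well-formed for the sequent, so only \<open>is_stack\<close> is demanded.\<close>
  define inv where "inv = (\<lambda>(p, a :: var \<Rightarrow> nat, \<Lambda>).
    p \<in> nodes P \<and> is_stack \<Lambda> \<and> \<not> sha \<Lambda> (seq_of P p))"
  define step where "step = (\<lambda>(p, a, \<Lambda>) (p', a', \<Lambda>').
    next_node P p p' \<and>
    a' = (\<lambda>x. if x \<in> fv_seq (seq_of P p') then Suc (a x) else 0) \<and>
    (\<exists>\<Lambda>\<^sub>1. push a (seq_of P p) (pop_stack (seq_of P p) \<Lambda>) \<Lambda>\<^sub>1 \<and>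
      (\<Lambda>' = \<Lambda>\<^sub>1 \<or> (\<exists>x. \<Lambda>' = raise x \<Lambda>\<^sub>1)) \<and>
      (\<forall>x. case_at P p x \<and> x \<in> fv_seq (seq_of P p') \<longrightarrow> \<Lambda>' = raise x \<Lambda>\<^sub>1)))"
  have inv_0: "inv ([], (\<lambda>x. 0), [])"
    using pre not_sha root
    by (simp add: inv_def is_preproof_def is_stack_def sha_provable_def)
  have step_ex: "\<exists>s'. inv s' \<and> step s s'" if inv: "inv s" for s
  proof -
    obtain p a \<Lambda> where s: "s = (p, a, \<Lambda>)" by (cases s)
    let ?S = "seq_of P p"
    have p: "p \<in> nodes P" and st: "is_stack \<Lambda>" and un: "\<not> sha \<Lambda> ?S"
      using inv by (auto simp: s inv_def)
    obtain \<Lambda>\<^sub>1 where push: "push a ?S (pop_stack ?S \<Lambda>) \<Lambda>\<^sub>1" using push_exists by blast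
    have wf: "well_formed \<Lambda>\<^sub>1 ?S"
      using well_formed_push[OF push] well_formed_pop_stack[OF st] by blast
    have "\<not> sha \<Lambda>\<^sub>1 ?S"
      using sha_push[OF push] sha_pop_stack st un well_formed_pop_stack by blast
    then obtain p' \<Lambda>' where next_p: "p' \<in> nodes P" "next_node P p p'" "\<not> sha \<Lambda>' (seq_of P p')"
      "\<Lambda>' = \<Lambda>\<^sub>1 \<or> (\<exists>x. \<Lambda>' = raise x \<Lambda>\<^sub>1)"
      "\<And>x. case_at P p x \<Longrightarrow> x \<in> fv_seq (seq_of P p') \<Longrightarrow> \<Lambda>' = raise x \<Lambda>\<^sub>1"
      using unprovable_next[OF pre p wf] by blast
    have "is_stack \<Lambda>'"
      using next_p(4) wf is_stack_raise by (auto simp: well_formed_def)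
    then have "inv (p', (\<lambda>x. if x \<in> fv_seq (seq_of P p') then Suc (a x) else 0), \<Lambda>')"
      using next_p by (simp add: inv_def)
    moreover have "step s (p', (\<lambda>x. if x \<in> fv_seq (seq_of P p') then Suc (a x) else 0), \<Lambda>')"
      unfolding step_def s using next_p push by auto
    ultimately show ?thesis by blast
  qed
  obtain f where f: "\<And>n. inv (f n)" "\<And>n. step (f n) (f (Suc n))" "f 0 = ([], (\<lambda>x. 0), [])"
  proof -
    have "\<exists>f. \<forall>n. (inv (f n) \<and> (n = 0 \<longrightarrow> f n = ([], (\<lambda>x. 0), []))) \<and> step (f n) (f (Suc n))"
      by (rule dependent_nat_choice) (use inv_0 step_ex in auto)
    then show ?thesis using that by blast
  qed
  define b where "b n = fst (f n)" for n
  define age where "age n = fst (snd (f n))" for n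
  define stk where "stk n = snd (snd (f n))" for n
  have f_eq: "f n = (b n, age n, stk n)" for n by (simp add: b_def age_def stk_def)
  have inv_n: "b n \<in> nodes P" "is_stack (stk n)" "\<not> sha (stk n) (seq_of P (b n))" for n
    using f(1)[of n] by (auto simp: inv_def f_eq)
  have next_n: "next_node P (b n) (b (Suc n))"
    and age_n: "age (Suc n) = (\<lambda>x. if x \<in> fv_seq (seq_of P (b (Suc n))) then Suc (age n x) else 0)"
    and "\<exists>\<Lambda>\<^sub>1. push (age n) (seq_of P (b n)) (pop_stack (seq_of P (b n)) (stk n)) \<Lambda>\<^sub>1 \<and>
      (stk (Suc n) = \<Lambda>\<^sub>1 \<or> (\<exists>x. stk (Suc n) = raise x \<Lambda>\<^sub>1)) \<and>
      (\<forall>x. case_at P (b n) x \<and> x \<in> fv_seq (seq_of P (b (Suc n))) \<longrightarrow> stk (Suc n) = raise x \<Lambda>\<^sub>1)"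
    for n
    using f(2)[of n] by (auto simp: step_def f_eq)
  \<comment> \<open>The stacks between pushing and raising are not part of the state and are chosen
    afterwards.\<close>
  then obtain full where full:
    "\<And>n. push (age n) (seq_of P (b n)) (pop_stack (seq_of P (b n)) (stk n)) (full n)"
    "\<And>n. stk (Suc n) = full n \<or> (\<exists>x. stk (Suc n) = raise x (full n))"
    "\<And>n x. case_at P (b n) x \<Longrightarrow> x \<in> fv_seq (seq_of P (b (Suc n))) \<Longrightarrow>
      stk (Suc n) = raise x (full n)"
    by metis
  interpret stack_run "\<lambda>n. seq_of P (b n)" age stk full "\<lambda>n. case_at P (b n)"
  proof
    have "finite (seq_of P ` nodes P)" using pre by (simp add: is_preproof_def)
    then show "finite (range (\<lambda>n. seq_of P (b n)))"
      by (rule finite_subset[rotated]) (use inv_n in auto)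
    show "stk 0 = []" using f(3) by (simp add: stk_def)
    \<comment> \<open>A positive label for the current sequent in the popped stack would make it
      derivable by Bud and Pop, against the invariant.\<close>
    show "Label x Pos_sign (seq_of P (b n)) \<notin> set (pop_stack (seq_of P (b n)) (stk n))" for n x
      using sha_bud[OF well_formed_pop_stack] sha_pop_stack inv_n by blast
  qed (use full age_n in auto)
  have "b 0 = []" using f(3) by (simp add: b_def)
  then have "infinite_branch P b"
    using next_n by (simp add: infinite_branch_def next_node_def)
  then obtain x m where "\<And>n. n \<ge> m \<Longrightarrow> x \<in> fv_seq (seq_of P (b n))"
    "\<exists>\<^sub>\<infinity>n. case_at P (b n) x"
    using P unfolding is_cha_proof_def case_at_def by blast
  then show False using no_progress by blast
qed

end
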